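(* Let $n>2$ be an integer and let $u$ be a vertex of the complete graph $K_n$ on $n$ vertices. The number $c_n$ of cycles through $u$ in $K_n$ is $$c_n=\lfloor e\,(n-1)!\rfloor-n,$$ and the sum $L_c(n)$ of the lengths of all these cycles is $$L_c(n)=\lfloor e\, n!\rfloor-\lfloor e\,(n-1)!\rfloor-2n+1 .$$
   Context: A cycle through $u$ of length $i$ (with $3\le i\le n$) is a sequence $(u,x_1,\dots,x_{i-1},u)$ where $x_1,\dots,x_{i-1}$ are pairwise distinct vertices different from $u$; distinct sequences are counted as distinct cycles (so a cycle traversed in the two directions is counted twice). $\lfloor x\rfloor$ denotes the floor of $x$. *)

theory Defs
  imports Complex_Main "Graph_Theory.Graph_Theory"
begin

(* The edges of a simple graph are represented by symmetric pairs of arcs, so the vertex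
   sequence u, x, u is a closed walk as well; the bound 3 excludes it. The bound by the number
   of vertices is implied by distinctness in a finite graph. A cycle and its reversal are
   different lists, hence different elements of this set. *)
definition cycles_through :: "('a, 'b) pre_digraph \<Rightarrow> 'a \<Rightarrow> 'a list set" where
  "cycles_through G u =
     {u # xs @ [u] | xs. distinct (u # xs) \<and> vwalk (u # xs @ [u]) G \<and>
        3 \<le> vwalk_length (u # xs @ [u])}"

end

theory Submission
  imports Defs
begin

text \<open>
  A cycle through \<open>u\<close> of length \<open>k + 1\<close> is an arrangement of \<open>k \<ge> 2\<close> of the other \<open>m = n - 1\<close>
  vertices, so there are \<open>m! / (m - k)!\<close> of them. Let \<open>a m\<close> be the sum of \<open>m! / j!\<close> over
  \<open>j \<le> m\<close>, the number of all arrangements. Truncating the exponential series at \<open>m \<ge> 1\<close> shows that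
  \<open>a m\<close> is the integer part of \<open>e m!\<close>. Writing \<open>k + 1 = (m + 1) - (m - k)\<close> shows that the sum of
  \<open>(k + 1) m! / (m - k)!\<close> over \<open>k \<le> m\<close> is \<open>a (m + 1) - a m\<close>. It remains to subtract the terms with
  \<open>k \<le> 1\<close>.
\<close>

definition arrangements :: "nat \<Rightarrow> nat" where
  "arrangements m = (\<Sum>j\<le>m. fact m div fact j)"

text \<open>Every \<open>div\<close> here is exact, as j! divides m! for j \<le> m. This ties the
  integer sum to a partial sum of the series for e.\<close>

lemma of_nat_arrangements:
  "real (arrangements m) = fact m * (\<Sum>j\<le>m. 1 / fact j)"
  by (simp add: arrangements_def sum_distrib_left real_of_nat_div fact_dvd)

lemma fact_Suc_div_fact:
  "j \<le> m \<Longrightarrow> fact (Suc m) div fact j = Suc m * (fact m div fact j :: nat)"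
  by (metis div_mult_swap fact_Suc fact_dvd of_nat_id)

lemma arrangements_Suc: "arrangements (Suc m) = Suc m * arrangements m + 1"
proof -
  have "(\<Sum>j\<le>m. fact (Suc m) div fact j) = (\<Sum>j\<le>m. Suc m * (fact m div fact j :: nat))"
    by (intro sum.cong refl fact_Suc_div_fact) simp
  then show ?thesis
    by (simp add: arrangements_def sum_distrib_left del: fact_Suc)
qed

text \<open>The Lagrange remainder at m itself is \<open>exp t / (m + 1)\<close>, and
  \<open>exp t < 3\<close> does not bring it below 1 when m = 1. So the remainder is estimated at m
  + 1 and carried back to m by the recurrence \<open>arrangements_Suc\<close>.\<close>

lemma exp_remainder_arrangements:
  assumes "m > 0"
  shows "exp 1 * fact m - real (arrangements m) \<in> {0..<1}"
proof -
  define r where "r k = exp 1 * fact k - real (arrangements k)" for k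
  obtain t where t: "\<bar>t\<bar> < \<bar>1::real\<bar>"
    "exp 1 = (\<Sum>j<Suc (Suc m). 1 ^ j / fact j) + exp t / fact (Suc (Suc m)) * 1 ^ Suc (Suc m)"
    using Maclaurin_exp_lt[of "1::real" "Suc (Suc m)"] by auto
  have "r (Suc m) = fact (Suc m) * (exp 1 - (\<Sum>j<Suc (Suc m). 1 / fact j))"
    unfolding r_def of_nat_arrangements lessThan_Suc_atMost by (simp add: algebra_simps)
  also have "\<dots> = fact (Suc m) * (exp t / fact (Suc (Suc m)))"
    using t(2) by simp
  also have "\<dots> = exp t / real (m + 2)"
    by (simp add: fact_Suc[of "Suc m"] del: fact_Suc)
  finally have r: "r (Suc m) = exp t / real (m + 2)" .
  have "exp t < 3"
    using t(1) exp_le exp_less_mono[of t 1] by linarith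
  then have "r (Suc m) < 1" "r (Suc m) \<ge> 0"
    unfolding r using assms by (simp_all add: field_simps)
  \<comment> \<open>As \<open>r (Suc m)\<close> lies in [0, 1), the product
    \<open>Suc m * r m\<close> is below 2, and dividing by \<open>Suc m\<close> \<ge> 2 gives
    \<open>r m < 1\<close>.\<close>
  moreover have "r (Suc m) = real (Suc m) * r m - 1"
    by (simp add: r_def arrangements_Suc algebra_simps)
  ultimately have "0 \<le> real (Suc m) * r m" "real (Suc m) * r m < 2"
    by linarith+
  moreover have "2 \<le> real (Suc m)"
    using assms by simp
  ultimately have "0 \<le> r m" "r m < 1"
    by (simp add: zero_le_mult_iff, smt (verit) mult_le_cancel_left1 mult_less_cancel_left1)
  then show ?thesis
    by (simp add: r_def)
qed

lemma floor_exp_fact: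
  assumes "m > 0"
  shows "\<lfloor>exp 1 * (fact m :: real)\<rfloor> = int (arrangements m)"
  using exp_remainder_arrangements[OF assms] by (simp add: floor_eq_iff)

text \<open>The factor j cancels against j!, leaving m! / (j - 1)!. The shifted sum stops at m! / (m
  - 1)!, and \<open>Suc\<close> supplies the missing last term m! / m! = 1.\<close>

lemma sum_index_times_fact_div_fact:
  "Suc (\<Sum>j\<le>m. j * (fact m div fact j)) = arrangements m"
proof (cases m)
  case (Suc p)
  have "Suc j * (fact m div fact (Suc j)) = fact m div fact j" if "j \<le> p" for j
  proof -
    have "(fact (Suc j) :: nat) dvd fact m"
      using that Suc by (intro fact_dvd) simp
    then obtain c :: nat where "fact m = fact (Suc j) * c" ..
    moreover have "fact (Suc j) * c = fact j * (Suc j * c)"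
      by (simp add: algebra_simps)
    ultimately show ?thesis
      by (metis fact_nonzero nonzero_mult_div_cancel_left)
  qed
  then have "(\<Sum>j\<le>p. Suc j * (fact m div fact (Suc j))) = (\<Sum>j\<le>p. fact m div fact j)"
    by (intro sum.cong) auto
  moreover have "(\<Sum>j\<le>m. j * (fact m div fact j)) = (\<Sum>j\<le>p. Suc j * (fact m div fact (Suc j)))"
    unfolding Suc sum.atMost_Suc_shift by (simp del: fact_Suc)
  ultimately show ?thesis
    by (simp add: arrangements_def Suc del: fact_Suc)
qed (simp add: arrangements_def)

lemma sum_atMost_diff_reindex: "(\<Sum>k\<le>m. f (m - k)) = (\<Sum>j\<le>(m::nat). f j)"
  using sum.nat_diff_reindex[of f "Suc m"] by (simp add: lessThan_Suc_atMost)

lemma sum_falling: "(\<Sum>k\<le>m. fact m div fact (m - k)) = arrangements m"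
  unfolding arrangements_def by (rule sum_atMost_diff_reindex)

lemma sum_falling_weighted:
  "(\<Sum>k\<le>m. (fact m div fact (m - k)) * (k + 1)) + arrangements m = arrangements (Suc m)"
proof -
  \<comment> \<open>Adding the complementary weights m - k makes the weight constant and avoids
    subtraction of naturals.\<close>
  have "(\<Sum>k\<le>m. (fact m div fact (m - k)) * (k + 1)) + (\<Sum>j\<le>m. j * (fact m div fact j)) =
      (\<Sum>k\<le>m. (fact m div fact (m - k)) * (k + 1)) + (\<Sum>k\<le>m. (m - k) * (fact m div fact (m - k)))"
    by (simp add: sum_atMost_diff_reindex[of "\<lambda>j. j * (fact m div fact j)"])
  also have "\<dots> = (\<Sum>k\<le>m. Suc m * (fact m div fact (m - k)))"
    unfolding sum.distrib[symmetric]
  proof (intro sum.cong refl)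
    fix k assume "k \<in> {..m}"
    then have "(k + 1) + (m - k) = Suc m" by simp
    then show "fact m div fact (m - k) * (k + 1) + (m - k) * (fact m div fact (m - k)) =
        Suc m * (fact m div fact (m - k))"
      by (metis add_mult_distrib mult.commute)
  qed
  also have "\<dots> = Suc m * arrangements m"
    unfolding sum_distrib_left[symmetric] sum_falling ..
  finally show ?thesis
    using sum_index_times_fact_div_fact[of m] by (simp add: arrangements_Suc)
qed

lemma finite_distinct_lists:
  "finite A \<Longrightarrow> finite {xs. distinct xs \<and> set xs \<subseteq> A}"
  using finite_subset_distinct[of A] by (simp add: conj_commute)

text \<open>Group the lists by their length k: the weight is constant on each group, and the group
  size is a falling factorial.\<close>

lemma sum_distinct_lists_length:
  fixes f :: "nat \<Rightarrow> nat"
  assumes "finite A"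
  shows "(\<Sum>xs | distinct xs \<and> set xs \<subseteq> A. f (length xs)) =
    (\<Sum>k\<le>card A. (fact (card A) div fact (card A - k)) * f k)"
proof -
  let ?D = "{xs. distinct xs \<and> set xs \<subseteq> A}"
  have "length ` ?D \<subseteq> {..card A}"
    using assms by (auto simp: card_mono simp flip: distinct_card)
  then have "(\<Sum>xs\<in>?D. f (length xs)) =
      (\<Sum>k\<le>card A. \<Sum>xs | xs \<in> ?D \<and> length xs = k. f (length xs))"
    using finite_distinct_lists[OF assms] by (intro sum.group[symmetric]) auto
  also have "\<dots> = (\<Sum>k\<le>card A. (fact (card A) div fact (card A - k)) * f k)"
  proof (intro sum.cong refl)
    fix k assume "k \<in> {..card A}"
    have "{xs. xs \<in> ?D \<and> length xs = k} = {xs. length xs = k \<and> distinct xs \<and> set xs \<subseteq> A}"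
      by auto
    then have "card {xs. xs \<in> ?D \<and> length xs = k} = fact (card A) div fact (card A - k)"
      using assms \<open>k \<in> {..card A}\<close>
      by (simp add: card_lists_distinct_length_eq fact_div_fact)
    then show "(\<Sum>xs | xs \<in> ?D \<and> length xs = k. f (length xs)) =
        (fact (card A) div fact (card A - k)) * f k"
      by simp
  qed
  finally show ?thesis .
qed

lemma vwalk_complete_digraph_iff:
  assumes "complete_digraph n G"
  shows "vwalk p G \<longleftrightarrow> p \<noteq> [] \<and> set p \<subseteq> verts G \<and> successively (\<noteq>) p"
proof -
  have "arcs_ends G = {(x, y). x \<in> verts G \<and> y \<in> verts G \<and> x \<noteq> y}"
    using assms by (auto simp: complete_digraph_def)
  then have "set p \<subseteq> verts G \<Longrightarrow> set (vwalk_arcs p) \<subseteq> arcs_ends G \<longleftrightarrow> successively (\<noteq>) p"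
    by (induction p rule: vwalk_arcs.induct) auto
  then show ?thesis
    by (auto simp: vwalk_def)
qed

lemma cycles_through_complete_digraph:
  assumes "complete_digraph n G" and "u \<in> verts G"
  shows "cycles_through G u = (\<lambda>xs. u # xs @ [u]) `
    {xs. distinct xs \<and> set xs \<subseteq> verts G - {u} \<and> 2 \<le> length xs}"
proof -
  have "successively (\<noteq>) (u # xs @ [u])"
    if "distinct (u # xs)" "2 \<le> length xs" for xs
  proof -
    have "successively (\<noteq>) (u # xs)"
      using that(1) unfolding successively_conv_nth by (metis Suc_lessD n_not_Suc_n nth_eq_iff_index_eq)
    \<comment> \<open>The closing arc is no loop: \<open>xs\<close> is nonempty, so the last vertex
      lies in \<open>xs\<close> and differs from u.\<close>
    moreover have "last (u # xs) \<noteq> u"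
      using that by (auto dest: last_in_set)
    ultimately have "successively (\<noteq>) ((u # xs) @ [u])"
      by (subst successively_append_iff) auto
    then show ?thesis by simp
  qed
  then show ?thesis
    using assms(2) unfolding cycles_through_def vwalk_complete_digraph_iff[OF assms(1)] by auto
qed

text \<open>The terms \<open>f 1\<close> and \<open>m * f 2\<close> belong to k = 0 and k = 1, the
  lists too short to form a cycle. A general \<open>f\<close> serves both the number of cycles and
  their total length.\<close>

lemma sum_cycles_through_complete_digraph:
  fixes f :: "nat \<Rightarrow> nat"
  assumes "complete_digraph (Suc m) G" and "u \<in> verts G" and "m > 0"
  shows "(\<Sum>p\<in>cycles_through G u. f (vwalk_length p)) + f 1 + m * f 2 =
    (\<Sum>k\<le>m. (fact m div fact (m - k)) * f (k + 1))"
proof -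
  let ?A = "verts G - {u}"
  have fin: "finite ?A" and card: "card ?A = m"
    using assms(1,2) unfolding complete_digraph_def
    by (auto simp: graph_def digraph_def fin_digraph.finite_verts)
  let ?g = "\<lambda>k. (fact m div fact (m - k)) * (if 2 \<le> k then f (k + 1) else 0)"
  let ?h = "\<lambda>k. (fact m div fact (m - k)) * f (k + 1)"
  have "(\<Sum>p\<in>cycles_through G u. f (vwalk_length p)) =
      (\<Sum>xs | distinct xs \<and> set xs \<subseteq> ?A \<and> 2 \<le> length xs. f (length xs + 1))"
    unfolding cycles_through_complete_digraph[OF assms(1,2)]
    by (subst sum.reindex) (auto simp: inj_on_def)
  also have "\<dots> = (\<Sum>xs | distinct xs \<and> set xs \<subseteq> ?A. if 2 \<le> length xs then f (length xs + 1) else 0)"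
    by (rule sum.mono_neutral_cong_left) (use finite_distinct_lists[OF fin] in auto)
  also have "\<dots> = (\<Sum>k\<le>m. ?g k)"
    using sum_distinct_lists_length[OF fin, of "\<lambda>k. if 2 \<le> k then f (k + 1) else 0"]
    by (simp add: card)
  finally have eq: "(\<Sum>p\<in>cycles_through G u. f (vwalk_length p)) = (\<Sum>k\<le>m. ?g k)" .
  obtain p where p: "m = Suc p"
    using assms(3) by (cases m) auto
  have split: "(\<Sum>k\<le>m. F k) = F 0 + F 1 + (\<Sum>k<p. F (k + 2))" for F :: "nat \<Rightarrow> nat"
    unfolding p sum.atMost_Suc_shift lessThan_Suc_atMost[symmetric] sum.lessThan_Suc_shift
    by (simp add: numeral_2_eq_2)
  have "fact m div fact (m - 1) = m"
    by (simp add: p)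
  then show ?thesis
    unfolding eq split[of ?g] split[of ?h] by (simp add: numeral_2_eq_2)
qed

theorem theorem4:
  fixes G :: "('a, 'b) pre_digraph" and n :: nat and u :: 'a
  assumes "n > 2" and "complete_digraph n G" and "u \<in> verts G"
  shows "finite (cycles_through G u)
    \<and> int (card (cycles_through G u)) = \<lfloor>exp 1 * (fact (n - 1) :: real)\<rfloor> - int n
    \<and> int (\<Sum>p \<in> cycles_through G u. vwalk_length p) =
        \<lfloor>exp 1 * (fact n :: real)\<rfloor> - \<lfloor>exp 1 * (fact (n - 1) :: real)\<rfloor> - 2 * int n + 1"
proof (intro conjI)
  obtain m where n: "n = Suc m" and "m > 0"
    using assms(1) by (cases n) auto
  note count = sum_cycles_through_complete_digraph[OF assms(2)[unfolded n] assms(3) \<open>m > 0\<close>]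
  have "finite (verts G - {u})"
    using assms(2) by (auto simp: complete_digraph_def graph_def digraph_def fin_digraph.finite_verts)
  from finite_distinct_lists[OF this] show "finite (cycles_through G u)"
    unfolding cycles_through_complete_digraph[OF assms(2,3)]
    by (intro finite_imageI) (auto elim: rev_finite_subset)
  \<comment> \<open>With constant weight 1 the excluded terms add up to 1 + m = n.\<close>
  have "card (cycles_through G u) + n = arrangements m"
    using count[of "\<lambda>_. 1"] by (simp add: sum_falling n)
  then show "int (card (cycles_through G u)) = \<lfloor>exp 1 * (fact (n - 1) :: real)\<rfloor> - int n"
    using floor_exp_fact[OF \<open>m > 0\<close>] by (simp add: n)
  define L where "L = (\<Sum>p\<in>cycles_through G u. vwalk_length p)"
  \<comment> \<open>With the length as weight the excluded terms add up to 1 + 2 m = 2 n -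
    1.\<close>
  have "L + 1 + 2 * m + arrangements m = arrangements n"
    using count[of "\<lambda>k. k"] sum_falling_weighted[of m] unfolding n L_def by linarith
  then have "int L = int (arrangements n) - int (arrangements m) - 2 * int n + 1"
    using n by linarith
  then show "int (\<Sum>p \<in> cycles_through G u. vwalk_length p) =
      \<lfloor>exp 1 * (fact n :: real)\<rfloor> - \<lfloor>exp 1 * (fact (n - 1) :: real)\<rfloor> - 2 * int n + 1"
    unfolding L_def n diff_Suc_1 floor_exp_fact[OF \<open>m > 0\<close>] floor_exp_fact[OF zero_less_Suc] .
qed

end
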